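(* Let $k\ge 1$ be an integer and let $f(z)=z+\sum_{n=1}^\infty a_{nk+1} z^{nk+1}$ be a function in $\mathcal{S}^*$ (the class of normalized starlike univalent functions on the open unit disk $\mathbb{U}$). Then $$ \left\vert a_{k+1}^2 - a_{2k+1}^2 \right\vert \leq \frac{4}{k^2}+\frac{(k+2)^2}{k^4}. $$ The estimate is sharp: for every integer $k\ge 1$ there is a function $f\in\mathcal{S}^*$ of the form $f(z)=z+\sum_{n=1}^\infty a_{nk+1} z^{nk+1}$ for which equality holds.
   Context: $\mathbb{U}=\{z\in\mathbb{C}:|z|<1\}$. $\mathcal{S}$ is the class of analytic univalent functions $f$ on $\mathbb{U}$ with expansion $f(z)=z+\sum_{n=2}^\infty a_n z^n$ (i.e. $f(0)=0$, $f'(0)=1$). $\mathcal{S}^*$ is the subclass of starlike functions: $f\in\mathcal{S}$ belongs to $\mathcal{S}^*$ if and only if $\operatorname{Re}\left(\frac{z f'(z)}{f(z)}\right)>0$ for all $z\in\mathbb{U}$ (the quotient being understood as $1$ at $z=0$). *)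

theory Defs
  imports "HOL-Complex_Analysis.Complex_Analysis"
begin

abbreviation unit_disk :: "complex set" where
  "unit_disk \<equiv> ball 0 1"

text \<open>Functions are total on the type of complex numbers; only their values on the disk matter.\<close>

definition class_S :: "(complex \<Rightarrow> complex) set" where
  "class_S = {f. f holomorphic_on unit_disk \<and> inj_on f unit_disk \<and> f 0 = 0 \<and> deriv f 0 = 1}"

text \<open>The quotient is read as its limit 1 at the origin, where division in HOL would give 0.\<close>

definition starlike_class :: "(complex \<Rightarrow> complex) set" where
  "starlike_class = {f \<in> class_S. \<forall>z\<in>unit_disk.
     Re (if z = 0 then 1 else z * deriv f z / f z) > 0}"

text \<open>
  The expansion \<open>f(z) = z + a\<^sub>k\<^sub>+\<^sub>1 z\<^sup>k\<^sup>+\<^sup>1 + a\<^sub>2\<^sub>k\<^sub>+\<^sub>1 z\<^sup>2\<^sup>k\<^sup>+\<^sup>1 + \<dots>\<close>. The sequence \<open>a\<close> is indexed by the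
  exponent of \<open>z\<close>, so only its values at the indices \<open>n * k + 1\<close> with \<open>n \<ge> 1\<close> are relevant.
  The series starts at \<open>n = 1\<close>, hence the shift by \<open>Suc\<close>.
\<close>

definition has_gap_expansion :: "nat \<Rightarrow> (nat \<Rightarrow> complex) \<Rightarrow> (complex \<Rightarrow> complex) \<Rightarrow> bool" where
  "has_gap_expansion k a f \<longleftrightarrow> (\<forall>z\<in>unit_disk.
     (\<lambda>n. a (Suc n * k + 1) * z ^ (Suc n * k + 1)) sums (f z - z))"

end

theory Submission
  imports Defs
begin

text \<open>
  The gap condition means \<open>f z = z * g (z ^ k)\<close> with \<open>g\<close> holomorphic on the disk and \<open>g 0 = 1\<close>, so
  that the starlikeness quotient is \<open>p (z ^ k)\<close> for \<open>p u = 1 + k u g' u / g u\<close>, a function with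
  positive real part. If \<open>p u = 1 + c\<^sub>1 u + c\<^sub>2 u\<^sup>2 + \<dots>\<close>, comparing coefficients yields
  \<open>k a\<^sub>k\<^sub>+\<^sub>1 = c\<^sub>1\<close> and \<open>2 k a\<^sub>2\<^sub>k\<^sub>+\<^sub>1 = c\<^sub>2 + c\<^sub>1 a\<^sub>k\<^sub>+\<^sub>1\<close>, and Caratheodory's bound
  \<open>\<bar>c\<^sub>n\<bar> \<le> 2\<close> with the triangle inequality gives the estimate. Equality requires the two squares
  to point in opposite directions; this happens for \<open>z * (1 - \<i> * z ^ k) powr (- 2 / k)\<close>, a rotated
  \<open>k\<close>-fold symmetric Koebe function, where \<open>\<i>\<^sup>2 = - 1\<close> and \<open>\<i>\<^sup>4 = 1\<close>. It is injective because its \<open>k\<close>-th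
  power is the Koebe function of \<open>z ^ k\<close>.
\<close>

section \<open>Coefficient bounds for functions with positive real part\<close>

text \<open>Cauchy's inequality applies on circles of radius \<open>r < 1\<close>; letting
  \<open>r\<close> tend to 1 removes the factor \<open>r ^ n\<close>.\<close>

lemma cmod_fps_nth_le_if_bounded:
  assumes hol: "w holomorphic_on ball 0 1" and W: "w has_fps_expansion W"
    and bd: "\<And>z. cmod z < 1 \<Longrightarrow> cmod (w z) \<le> B"
  shows "cmod (fps_nth W n) \<le> B"
proof -
  have le: "cmod (fps_nth W n) * r ^ n \<le> B" if r: "0 < r" "r < 1" for r :: real
  proof -
    have "cmod ((deriv ^^ n) w 0) \<le> fact n * B / r ^ n"
    proof (rule Cauchy_inequality)
      show "w holomorphic_on ball 0 r"
        using hol r by (rule_tac holomorphic_on_subset) auto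
      show "continuous_on (cball 0 r) w"
        using hol r by (intro holomorphic_on_imp_continuous_on holomorphic_on_subset[OF hol]) auto
    qed (use r bd in auto)
    thus ?thesis
      using r by (simp add: fps_nth_fps_expansion[OF W] norm_divide field_simps)
  qed
  have "((\<lambda>r. cmod (fps_nth W n) * r ^ n) \<longlongrightarrow> cmod (fps_nth W n) * 1 ^ n) (at_left 1)"
    by (intro tendsto_intros)
  moreover have "eventually (\<lambda>r::real. cmod (fps_nth W n) * r ^ n \<le> B) (at_left 1)"
    using eventually_at_left_real[of 0 1] by (rule eventually_mono) (use le in auto)
  ultimately show ?thesis
    using tendsto_upperbound[of _ _ "at_left (1::real)"] by fastforce
qed

text \<open>Since \<open>0 < m < n\<close>, \<open>cis (2 * pi / n) ^ m\<close> is an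
  \<open>n\<close>-th root of unity other than 1, so its geometric sum vanishes.\<close>

lemma sum_powers_root_of_unity:
  fixes n m :: nat
  assumes "0 < m" "m < n"
  shows "(\<Sum>j<n. (cis (2 * pi / n) ^ j) ^ m) = 0"
proof -
  define x where "x = cis (2 * pi / n) ^ m"
  have xe: "x = exp (2 * of_real pi * \<i> * of_nat m / of_nat n)"
    by (simp add: x_def cis_conv_exp exp_of_nat_mult [symmetric] field_simps)
  have "x \<noteq> 1"
    using complex_root_unity_eq[of n m 0] assms by (simp add: xe cong_def)
  moreover have "x ^ n = 1"
    using assms complex_root_unity[of n m] by (simp add: xe)
  ultimately have "(\<Sum>j<n. x ^ j) = 0"
    using geometric_sum[of x n] by simp
  moreover have "(cis (2 * pi / n) ^ j) ^ m = x ^ j" for j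
    by (simp add: x_def power_mult [symmetric] mult.commute)
  ultimately show ?thesis by simp
qed

text \<open>Averaging \<open>p\<close> over the rotations by \<open>n\<close>-th roots of unity kills the coefficients strictly between
  \<open>0\<close> and \<open>n\<close>. Hence the \<open>n\<close>-th coefficient of the Cayley transform of the average, which Cauchy's
  estimate bounds by \<open>1\<close>, is half that of \<open>p\<close>.\<close>
lemma Caratheodory_coefficient_bound:
  assumes hol: "p holomorphic_on ball 0 1" and P: "p has_fps_expansion P"
    and p0: "p 0 = 1" and pos: "\<And>z. cmod z < 1 \<Longrightarrow> Re (p z) > 0" and "n > 0"
  shows "cmod (fps_nth P n) \<le> 2"
proof -
  define \<omega> where "\<omega> = cis (2 * pi / n)"
  define q where "q = (\<lambda>z. of_real (1 / n) * (\<Sum>j<n. p (\<omega> ^ j * z)))"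
  define Q where "Q = fps_const (of_real (1 / n)) * (\<Sum>j<n. fps_compose P (fps_const (\<omega> ^ j) * fps_X))"
  have Q: "q has_fps_expansion Q"
    unfolding q_def Q_def
  proof (intro fps_expansion_intros)
    fix j
    show "(\<lambda>z. p (\<omega> ^ j * z)) has_fps_expansion fps_compose P (fps_const (\<omega> ^ j) * fps_X)"
      using has_fps_expansion_compose[OF P has_fps_expansion_cmult_left[OF has_fps_expansion_fps_X, of "\<omega> ^ j"]]
      by (simp add: o_def)
  qed
  have Qm: "fps_nth Q m = (\<Sum>j<n. (\<omega> ^ j) ^ m) * fps_nth P m / of_nat n" for m
    by (simp add: Q_def fps_sum_nth sum_distrib_right)
  have P0: "fps_nth P 0 = 1"
    using p0 has_fps_expansion_imp_0_eq_fps_nth_0[OF P] by simp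
  have Q0: "fps_nth Q 0 = 1"
    using \<open>n > 0\<close> by (simp add: Qm P0)
  have Qlt: "fps_nth Q m = 0" if "0 < m" "m < n" for m
    using sum_powers_root_of_unity[OF that] by (simp add: Qm \<omega>_def)
  have "\<omega> ^ n = 1"
    using \<open>n > 0\<close> by (simp add: \<omega>_def Complex.DeMoivre)
  hence "(\<omega> ^ j) ^ n = 1" for j
    by (metis mult.commute power_mult power_one)
  hence Qn: "fps_nth Q n = fps_nth P n"
    using \<open>n > 0\<close> by (simp add: Qm)
  have nrm: "cmod (\<omega> ^ j * z) = cmod z" for j z
    by (simp add: \<omega>_def norm_mult norm_power)
  have holq: "q holomorphic_on ball 0 1"
    unfolding q_def
    by (intro holomorphic_intros holomorphic_on_compose_gen[OF _ hol, unfolded o_def])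
       (use \<open>n > 0\<close> in \<open>auto simp: nrm\<close>)
  have posq: "Re (q z) > 0" if "cmod z < 1" for z
  proof -
    have "Re (\<Sum>j<n. p (\<omega> ^ j * z)) > 0"
      unfolding Re_sum using \<open>n > 0\<close> that by (intro sum_pos pos) (auto simp: nrm)
    thus ?thesis using \<open>n > 0\<close> by (simp add: q_def)
  qed

  define w where "w = (\<lambda>z. (q z - 1) / (q z + 1))"
  define W where "W = (Q - 1) / (Q + 1)"
  have ne: "q z + 1 \<noteq> 0" if "cmod z < 1" for z
    using posq[OF that] by (auto simp: complex_eq_iff)
  have holw: "w holomorphic_on ball 0 1"
    unfolding w_def by (intro holomorphic_intros holq) (use ne in auto)
  have W: "w has_fps_expansion W"
    unfolding w_def W_def by (intro fps_expansion_intros Q) (simp add: Q0)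
  have "cmod (w z) \<le> 1" if "cmod z < 1" for z
  proof -
    \<comment> \<open>The squared moduli differ by \<open>4 * Re (q z)\<close>.\<close>
    have "cmod (q z - 1) \<le> cmod (q z + 1)"
      unfolding cmod_def using posq[OF that]
      by (intro real_sqrt_le_mono) (simp add: power2_eq_square algebra_simps)
    thus ?thesis using ne[OF that] by (simp add: w_def norm_divide)
  qed
  hence Wn: "cmod (fps_nth W n) \<le> 1"
    using cmod_fps_nth_le_if_bounded[OF holw W] by blast
  have WQ: "W * (Q + 1) = Q - 1"
    using inverse_mult_eq_1[of "Q + 1"] by (simp add: W_def Q0 fps_divide_unit mult.assoc)
  have W0: "fps_nth W 0 = 0"
    using arg_cong[OF WQ, of "\<lambda>F. fps_nth F 0"] by (simp add: Q0)
  have "fps_nth (W * (Q + 1)) n = (\<Sum>i=0..n. fps_nth W i * fps_nth (Q + 1) (n - i))"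
    by (simp add: fps_mult_nth)
  \<comment> \<open>Terms with \<open>0 < i < n\<close> vanish because the coefficients of
    \<open>Q\<close> strictly between 0 and \<open>n\<close> do; the constant coefficient of
    \<open>Q + 1\<close> then gives the factor 2.\<close>
  also have "\<dots> = (\<Sum>i\<in>{n}. fps_nth W i * fps_nth (Q + 1) (n - i))"
  proof (rule sum.mono_neutral_right)
    show "\<forall>i\<in>{0..n} - {n}. fps_nth W i * fps_nth (Q + 1) (n - i) = 0"
    proof
      fix i assume "i \<in> {0..n} - {n}"
      thus "fps_nth W i * fps_nth (Q + 1) (n - i) = 0"
        by (cases "i = 0") (auto simp: W0 Qlt)
    qed
  qed auto
  also have "\<dots> = 2 * fps_nth W n"
    by (simp add: Q0)
  finally have "fps_nth P n = 2 * fps_nth W n"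
    using \<open>n > 0\<close> by (simp add: WQ Qn)
  thus ?thesis using Wn by (simp add: norm_mult)
qed

section \<open>Starlike functions with a gap expansion\<close>

text \<open>Carries statements about the points \<open>z ^ k\<close> over to every point
  \<open>u\<close> of the disk.\<close>

lemma root_in_unit_disk:
  assumes "k \<ge> 1" "cmod u < 1"
  obtains z where "cmod z < 1" "z ^ k = u"
proof -
  obtain z where z: "z ^ k = u"
    using exists_complex_root[of k u] assms(1) by auto
  have "cmod z ^ k < 1 ^ k"
    using assms(2) z by (simp flip: norm_power)
  hence "cmod z < 1"
    by (rule power_less_imp_less_base) simp
  thus ?thesis using that z by blast
qed

text \<open>The leading \<open>z\<close> supplies the coefficient 1 at \<open>n = 0\<close>, which
  turns the gap series into \<open>z\<close> times a power series in \<open>z ^ k\<close>.\<close>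

lemma gap_expansion_sums:
  assumes "has_gap_expansion k a f" "cmod z < 1"
  shows "(\<lambda>n. (if n = 0 then 1 else a (n * k + 1)) * (z ^ k) ^ n * z) sums f z"
proof -
  have "(\<lambda>n. a (Suc n * k + 1) * z ^ (Suc n * k + 1)) sums (f z - z)"
    using assms by (simp add: has_gap_expansion_def)
  moreover have "a (Suc n * k + 1) * z ^ (Suc n * k + 1) = a (Suc n * k + 1) * (z ^ k) ^ Suc n * z" for n
    by (simp only: power_add power_mult mult.commute[of _ k] power_one_right mult.assoc)
  ultimately have "(\<lambda>n. (if Suc n = 0 then 1 else a (Suc n * k + 1)) * (z ^ k) ^ Suc n * z) sums (f z - z)"
    by (simp only: nat.distinct if_False)
  from sums_Suc[OF this] show ?thesis
    by simp
qed

lemma starlike_quotient: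
  assumes k: "k \<ge> 1" and z: "cmod z < 1" "z \<noteq> 0"
    and f: "\<And>z. cmod z < 1 \<Longrightarrow> f z = z * g (z ^ k)"
    and g: "g holomorphic_on ball 0 1" and nz: "g (z ^ k) \<noteq> 0"
  shows "z * deriv f z / f z = 1 + of_nat k * z ^ k * deriv g (z ^ k) / g (z ^ k)"
proof -
  have zk: "cmod (z ^ k) < 1"
    using z k by (simp add: norm_power power_less_one_iff)
  have dg: "(g has_field_derivative deriv g (z ^ k)) (at (z ^ k))"
    using holomorphic_derivI[OF g] zk by simp
  have "((\<lambda>z. z * g (z ^ k)) has_field_derivative
          g (z ^ k) + z * (deriv g (z ^ k) * (of_nat k * z ^ (k - 1)))) (at z)"
    by (rule derivative_eq_intros DERIV_chain2[where f = g and g = "\<lambda>z. z ^ k", OF dg] refl | simp)+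
  \<comment> \<open>The formula for \<open>f\<close> is known on the disk only, but this is a
    neighbourhood of \<open>z\<close>, so the derivative carries over.\<close>
  moreover have "\<forall>\<^sub>F w in nhds z. w * g (w ^ k) = f w"
    using eventually_nhds_in_open[of "ball 0 1" z] z f by (auto elim!: eventually_mono)
  ultimately have "(f has_field_derivative
          g (z ^ k) + z * (deriv g (z ^ k) * (of_nat k * z ^ (k - 1)))) (at z)"
    by (subst (asm) DERIV_cong_ev[OF refl _ refl]) auto
  hence "deriv f z = g (z ^ k) + of_nat k * (z * z ^ (k - 1)) * deriv g (z ^ k)"
    by (simp add: DERIV_imp_deriv mult_ac)
  also have "z * z ^ (k - 1) = z ^ k"
    using k by (simp flip: power_Suc)
  finally have "deriv f z = g (z ^ k) + of_nat k * z ^ k * deriv g (z ^ k)" .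
  thus ?thesis
    using f[OF z(1)] z(2) nz by (simp add: field_simps)
qed

text \<open>\<open>P\<close> expands the \<open>p\<close> for which \<open>p (z ^ k)\<close> is the
  starlikeness quotient. The equations compare the coefficients of \<open>u\<close> and
  \<open>u ^ 2\<close> in \<open>p u * g u = g u + k * u * g' u\<close>.\<close>

lemma starlike_coefficient_relations:
  assumes k: "k \<ge> 1" and S: "f \<in> starlike_class" and a: "has_gap_expansion k a f"
  obtains P where "cmod (fps_nth P 1) \<le> 2" "cmod (fps_nth P 2) \<le> 2"
    "of_nat k * a (k + 1) = fps_nth P 1"
    "2 * of_nat k * a (2 * k + 1) = fps_nth P 2 + fps_nth P 1 * a (k + 1)"
proof -
  \<comment> \<open>The gap expansion does not determine \<open>a 1\<close>, so the constant
    coefficient is set to 1 explicitly.\<close>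
  define G where "G = Abs_fps (\<lambda>n. if n = 0 then 1 else a (n * k + 1))"
  define g where "g = eval_fps G"
  define p where "p = (\<lambda>u. (g u + of_nat k * (u * deriv g u)) / g u)"
  define P where "P = (G + fps_const (of_nat k) * (fps_X * fps_deriv G)) / G"
  have inj: "inj_on f (ball 0 1)" and f0: "f 0 = 0"
    using S by (simp_all add: starlike_class_def class_S_def)
  have pos: "Re (z * deriv f z / f z) > 0" if "cmod z < 1" "z \<noteq> 0" for z
  proof -
    have "Re (if z = 0 then 1 else z * deriv f z / f z) > 0"
      using S that(1) unfolding starlike_class_def by (simp only: mem_Collect_eq mem_ball_0)
    thus ?thesis using that(2) by (simp only: if_False)
  qed
  have sm: "(\<lambda>n. fps_nth G n * (z ^ k) ^ n * z) sums f z" if "cmod z < 1" for z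
    using gap_expansion_sums[OF a that] by (simp add: G_def)
  \<comment> \<open>Convergence at \<open>u\<close> comes from the series of \<open>f\<close> at a
    \<open>k\<close>-th root \<open>z\<close> of \<open>u\<close>, divided by
    \<open>z\<close>.\<close>
  have sG: "summable (\<lambda>n. fps_nth G n * u ^ n)" if u: "cmod u < 1" for u
  proof (cases "u = 0")
    case False
    obtain z where z: "cmod z < 1" "z ^ k = u"
      using root_in_unit_disk[OF k u] .
    have "z \<noteq> 0"
      using False k z(2) by (metis not_one_le_zero power_eq_0_iff zero_power zero_less_iff_neq_zero)
    thus ?thesis
      using summable_mult2[OF sums_summable[OF sm[OF z(1)]], of "inverse z"] z(2)
      by (simp add: mult.assoc)
  qed simp
  have rad: "fps_conv_radius G \<ge> 1"
    unfolding fps_conv_radius_def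
    by (intro conv_radius_geI_ex' sG) (auto simp: one_ereal_def)
  have holg: "g holomorphic_on ball 0 1"
    unfolding g_def
  proof (intro holomorphic_on_eval_fps subsetI)
    fix z :: complex assume "z \<in> ball 0 1"
    hence "ereal (cmod z) < 1" by (simp add: one_ereal_def)
    from less_le_trans[OF this rad] show "z \<in> eball 0 (fps_conv_radius G)"
      by (simp add: in_eball_iff)
  qed
  have "fps_conv_radius G > 0"
    using rad by (rule less_le_trans[rotated]) simp
  hence gG: "g has_fps_expansion G"
    unfolding g_def by (rule eval_fps_has_fps_expansion)
  have fg: "f z = z * g (z ^ k)" if z: "cmod z < 1" for z
  proof -
    have "cmod (z ^ k) < 1"
      using z k by (simp add: norm_power power_less_one_iff)
    hence "(\<lambda>n. fps_nth G n * (z ^ k) ^ n * z) sums (g (z ^ k) * z)"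
      unfolding g_def eval_fps_def by (intro sums_mult2 summable_sums sG)
    thus ?thesis
      using sm[OF z] sums_unique2 by (simp add: mult.commute) blast
  qed
  have G0: "fps_nth G 0 = 1"
    by (simp add: G_def)
  have g0: "g 0 = 1"
    by (simp add: g_def eval_fps_at_0 G0)
  \<comment> \<open>Injectivity and \<open>f 0 = 0\<close> exclude further zeros of
    \<open>f\<close>, hence zeros of \<open>g\<close> away from 0; at 0 both \<open>g\<close> and
    \<open>p\<close> equal 1.\<close>
  have nz: "g u \<noteq> 0" and posp: "Re (p u) > 0" if u: "cmod u < 1" for u
  proof -
    have "g u \<noteq> 0 \<and> Re (p u) > 0"
    proof (cases "u = 0")
      case False
      obtain z where z: "cmod z < 1" "z ^ k = u"
        using root_in_unit_disk[OF k u] .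
      have "z \<noteq> 0"
        using False k z(2) by (metis not_one_le_zero power_eq_0_iff zero_power zero_less_iff_neq_zero)
      hence "f z \<noteq> 0"
        using inj_onD[OF inj, of z 0] f0 z by auto
      hence "g u \<noteq> 0"
        using fg[OF z(1)] z(2) by auto
      moreover have "p u = z * deriv f z / f z"
        using starlike_quotient[OF k z(1) \<open>z \<noteq> 0\<close> fg holg] calculation z(2)
        by (simp add: p_def add_divide_distrib mult.assoc)
      ultimately show ?thesis
        using pos[OF z(1) \<open>z \<noteq> 0\<close>] by simp
    qed (simp add: p_def g0)
    thus "g u \<noteq> 0" "Re (p u) > 0" by auto
  qed
  have holp: "p holomorphic_on ball 0 1"
    unfolding p_def by (intro holomorphic_intros holg) (use nz in auto)
  have pP: "p has_fps_expansion P"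
    unfolding p_def P_def by (intro fps_expansion_intros gG) (simp add: G0)
  have bound: "cmod (fps_nth P n) \<le> 2" if "n > 0" for n
    using Caratheodory_coefficient_bound[OF holp pP _ posp that] by (simp add: p_def g0)
  have "P * G = G + fps_const (of_nat k) * (fps_X * fps_deriv G)"
    unfolding P_def by (simp add: G0 fps_divide_unit)
      (metis G0 inverse_mult_eq_1 mult.assoc mult_1_right zero_neq_one)
  note eq = arg_cong[OF this, of "\<lambda>F. fps_nth F _"]
  have P0: "fps_nth P 0 = 1"
    using eq[of 0] by (simp add: G0)
  have G1: "fps_nth G 1 = a (k + 1)" and G2: "fps_nth G 2 = a (2 * k + 1)"
    by (simp_all add: G_def)
  have "of_nat k * a (k + 1) = fps_nth P 1"
    using eq[of 1] by (simp add: fps_mult_nth G0 P0 G1 [simplified])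
  moreover have "2 * of_nat k * a (2 * k + 1) = fps_nth P 2 + fps_nth P 1 * a (k + 1)"
    using eq[of 2] G1 G2 by (simp add: fps_mult_nth G0 P0 numeral_2_eq_2) (simp add: algebra_simps)
  ultimately show ?thesis
    using bound[of 1] bound[of 2] by (intro that[of P]) simp_all
qed

text \<open>The first bound enters the second: \<open>2 * k\<close> times the modulus of
  \<open>a (2 * k + 1)\<close> is at most \<open>2 + 2 * (2 / k)\<close>.\<close>

lemma starlike_gap_coefficient_bounds:
  assumes k: "k \<ge> 1" and "f \<in> starlike_class" "has_gap_expansion k a f"
  shows "cmod (a (k + 1)) \<le> 2 / real k" "cmod (a (2 * k + 1)) \<le> (real k + 2) / (real k)\<^sup>2"
proof -
  obtain P where P: "cmod (fps_nth P 1) \<le> 2" "cmod (fps_nth P 2) \<le> 2"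
    "of_nat k * a (k + 1) = fps_nth P 1"
    "2 * of_nat k * a (2 * k + 1) = fps_nth P 2 + fps_nth P 1 * a (k + 1)"
    using starlike_coefficient_relations[OF assms] .
  have "real k * cmod (a (k + 1)) \<le> 2"
    using P(1) unfolding P(3)[symmetric] by (simp add: norm_mult)
  thus 1: "cmod (a (k + 1)) \<le> 2 / real k"
    using k by (simp add: field_simps)
  have "2 * k * cmod (a (2 * k + 1)) = cmod (2 * of_nat k * a (2 * k + 1))"
    by (simp add: norm_mult)
  also have "\<dots> \<le> cmod (fps_nth P 2) + cmod (fps_nth P 1) * cmod (a (k + 1))"
    unfolding P(4) norm_mult[symmetric] by (rule norm_triangle_ineq)
  also have "\<dots> \<le> 2 + 2 * (2 / k)"
    using P(1,2) 1 by (intro add_mono mult_mono) auto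
  finally show "cmod (a (2 * k + 1)) \<le> (real k + 2) / (real k)\<^sup>2"
    using k by (simp add: field_simps power2_eq_square)
qed

section \<open>Symmetric Koebe functions as extremal functions\<close>

text \<open>After clearing denominators, the difference of the two sides factors as
  \<open>(u - v) * (1 - c * u * (c * v))\<close>, and the second factor is nonzero on the
  disk.\<close>

lemma Koebe_inj:
  fixes u v c :: complex
  assumes "cmod c = 1" "cmod u < 1" "cmod v < 1"
    and eq: "u / (1 - c * u)\<^sup>2 = v / (1 - c * v)\<^sup>2"
  shows "u = v"
proof -
  have ne: "1 - c * x \<noteq> 0" if "cmod x < 1" for x
    using that assms(1) by (metis eq_iff_diff_eq_0 mult_cancel_right1 norm_mult norm_one less_irrefl)
  have "(u - v) * (1 - (c * u) * (c * v)) = u * (1 - c * v)\<^sup>2 - v * (1 - c * u)\<^sup>2"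
    by (simp add: algebra_simps power2_eq_square)
  also have "\<dots> = 0"
    using eq ne assms(2,3) by (simp add: frac_eq_eq)
  finally have "(u - v) * (1 - (c * u) * (c * v)) = 0" .
  moreover have "cmod (c * u * (c * v)) < 1"
    using assms mult_strict_mono'[of "cmod u" 1 "cmod v" 1] by (simp add: norm_mult)
  hence "1 - c * u * (c * v) \<noteq> 0"
    by (metis eq_iff_diff_eq_0 norm_one less_irrefl)
  ultimately show ?thesis by simp
qed

definition symmetric_Koebe :: "nat \<Rightarrow> complex \<Rightarrow> complex \<Rightarrow> complex" where
  "symmetric_Koebe k c z = z * (1 - c * z ^ k) powr (- 2 / of_nat k)"

context
  fixes k :: nat and c :: complex
  assumes k: "k \<ge> 1" and c: "cmod c = 1"
begin

text \<open>Keeps the base of the principal power away from 0 and from the branch cut.\<close>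

lemma Re_one_minus_mult_pos: "Re (1 - c * u) > 0" if "cmod u < 1"
  using complex_Re_le_cmod[of "c * u"] that c by (simp add: norm_mult)

lemma power_in_unit_disk: "cmod (z ^ k) < 1" if "cmod z < 1"
  using that k by (simp add: norm_power power_less_one_iff)

lemma has_field_derivative_Koebe_powr:
  assumes "cmod u < 1"
  shows "((\<lambda>u. (1 - c * u) powr (- 2 / of_nat k)) has_field_derivative
           2 * c / (of_nat k * (1 - c * u)) * (1 - c * u) powr (- 2 / of_nat k)) (at u)"
proof -
  have "1 - c * u \<notin> \<real>\<^sub>\<le>\<^sub>0" "1 - c * u \<noteq> 0"
    using Re_one_minus_mult_pos[OF assms] by (auto simp: complex_nonpos_Reals_iff complex_eq_iff)
  thus ?thesis
    by (auto intro!: derivative_eq_intros simp: powr_diff field_simps)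
qed

text \<open>The \<open>k\<close>-th power turns the exponent \<open>- 2 / k\<close> into the integer
  \<open>- 2\<close>, so that injectivity reduces to that of the Koebe function.\<close>

lemma symmetric_Koebe_power:
  assumes "cmod z < 1"
  shows "symmetric_Koebe k c z ^ k = z ^ k / (1 - c * z ^ k)\<^sup>2"
proof -
  have "1 - c * z ^ k \<noteq> 0"
    using Re_one_minus_mult_pos[OF power_in_unit_disk[OF assms]] by (simp only: complex_eq_iff) auto
  hence "((1 - c * z ^ k) powr (- 2 / of_nat k)) ^ k = (1 - c * z ^ k) powr (- 2)"
    using k by (simp add: powr_def flip: exp_of_nat_mult)
  also have "\<dots> = inverse ((1 - c * z ^ k)\<^sup>2)"
    using \<open>1 - c * z ^ k \<noteq> 0\<close> powr_nat[of "1 - c * z ^ k" 2] by (simp add: powr_minus)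
  finally show ?thesis
    by (simp add: symmetric_Koebe_def power_mult_distrib divide_inverse)
qed

lemma symmetric_Koebe_starlike: "symmetric_Koebe k c \<in> starlike_class"
proof -
  define g where "g = (\<lambda>u. (1 - c * u) powr (- 2 / of_nat k))"
  have g: "g holomorphic_on ball 0 1"
    unfolding g_def holomorphic_on_open[OF open_ball] using has_field_derivative_Koebe_powr by (metis mem_ball_0)
  have ne: "1 - c * u \<noteq> 0" if "cmod u < 1" for u
    using Re_one_minus_mult_pos[OF that] by (auto simp: complex_eq_iff)
  have gnz: "g u \<noteq> 0" if "cmod u < 1" for u
    using ne[OF that] by (simp add: g_def)
  have fg: "symmetric_Koebe k c z = z * g (z ^ k)" for z
    by (simp add: symmetric_Koebe_def g_def)
  have hol: "symmetric_Koebe k c holomorphic_on ball 0 1"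
    unfolding fg[abs_def]
    by (intro holomorphic_intros holomorphic_on_compose_gen[OF _ g, unfolded o_def])
       (auto intro: power_in_unit_disk)
  have "inj_on (symmetric_Koebe k c) (ball 0 1)"
  proof (rule inj_onI)
    fix z w assume zw: "z \<in> ball 0 1" "w \<in> ball 0 1" "symmetric_Koebe k c z = symmetric_Koebe k c w"
    hence disk: "cmod z < 1" "cmod w < 1" by simp_all
    have "z ^ k / (1 - c * z ^ k)\<^sup>2 = w ^ k / (1 - c * w ^ k)\<^sup>2"
      using zw(3) by (simp only: disk flip: symmetric_Koebe_power)
    hence "z ^ k = w ^ k"
      by (rule Koebe_inj[OF c power_in_unit_disk[OF disk(1)] power_in_unit_disk[OF disk(2)]])
    \<comment> \<open>Equal \<open>k\<close>-th powers make the factors \<open>g (z ^ k)\<close> and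
      \<open>g (w ^ k)\<close> coincide; being nonzero, they cancel.\<close>
    thus "z = w"
      using zw(3) gnz[OF power_in_unit_disk[OF disk(2)]] unfolding fg by simp
  qed
  moreover have "deriv (symmetric_Koebe k c) 0 = 1"
  proof (rule DERIV_imp_deriv)
    \<comment> \<open>The difference quotient at 0 is \<open>g (z ^ k)\<close>, so continuity of
      \<open>g\<close> at 0 suffices.\<close>
    have "((\<lambda>z. g (z ^ k)) \<longlongrightarrow> g (0 ^ k)) (at 0)"
    proof (rule isCont_tendsto_compose[of _ g])
      show "isCont g (0 ^ k)"
        using k holomorphic_on_imp_continuous_on[OF g] continuous_on_interior[of "ball 0 1" g 0]
        by (simp add: zero_power)
    qed (intro tendsto_intros)
    hence "((\<lambda>z. g (z ^ k)) \<longlongrightarrow> 1) (at 0)"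
      using k by (simp add: g_def zero_power)
    moreover have "\<forall>\<^sub>F z in at 0. g (z ^ k) = symmetric_Koebe k c z / z"
      by (simp add: eventually_at_filter fg)
    ultimately have "((\<lambda>z. symmetric_Koebe k c z / z) \<longlongrightarrow> 1) (at 0)"
      by (rule Lim_transform_eventually)
    thus "(symmetric_Koebe k c has_field_derivative 1) (at 0)"
      by (simp add: has_field_derivative_iff fg)
  qed
  moreover have "Re (z * deriv (symmetric_Koebe k c) z / symmetric_Koebe k c z) > 0"
    if z: "cmod z < 1" "z \<noteq> 0" for z
  proof -
    define u where "u = z ^ k"
    have u: "cmod u < 1" using power_in_unit_disk z by (simp add: u_def)
    have "z * deriv (symmetric_Koebe k c) z / symmetric_Koebe k c z = 1 + of_nat k * u * deriv g u / g u"
      unfolding u_def using gnz u by (intro starlike_quotient k z fg g) (simp add: u_def)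
    also have "deriv g u = 2 * c / (of_nat k * (1 - c * u)) * g u"
      unfolding g_def by (intro DERIV_imp_deriv has_field_derivative_Koebe_powr u)
    \<comment> \<open>The quotient becomes the Moebius map \<open>(1 + w) / (1 - w)\<close> at
      \<open>w = c * u\<close>, which sends the disk to the right half-plane.\<close>
    also have "1 + of_nat k * u * (2 * c / (of_nat k * (1 - c * u)) * g u) / g u =
                 (1 + c * u) / (1 - c * u)"
      using ne[OF u] gnz[OF u] k by (simp add: divide_simps)
    also have "Re \<dots> = (1 - (cmod (c * u))\<^sup>2) / (cmod (1 - c * u))\<^sup>2"
      by (simp add: Re_divide cmod_power2) (simp add: power2_eq_square algebra_simps)
    also have "\<dots> > 0"
      using u c ne[OF u] by (intro divide_pos_pos) (auto simp: norm_mult power_less_one_iff)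
    finally show ?thesis .
  qed
  ultimately show ?thesis
    using hol by (auto simp: starlike_class_def class_S_def symmetric_Koebe_def)
qed

text \<open>The coefficient at exponent \<open>n * k + 1\<close> is the \<open>n\<close>-th binomial coefficient, and \<open>n\<close> is recovered
  as \<open>(m - 1) div k\<close>; the values at other exponents are irrelevant.\<close>
lemma symmetric_Koebe_gap_expansion:
  "has_gap_expansion k (\<lambda>m. (- 2 / of_nat k gchoose ((m - 1) div k)) * (- c) ^ ((m - 1) div k))
     (symmetric_Koebe k c)"
  unfolding has_gap_expansion_def
proof
  fix z :: complex assume "z \<in> ball 0 1"
  hence "cmod (- c * z ^ k) < 1"
    using power_in_unit_disk c by (simp add: norm_mult)
  from gen_binomial_complex[OF this, of "- 2 / of_nat k", THEN sums_mult2, of z]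
  have "(\<lambda>n. (- 2 / of_nat k gchoose n) * (- c * z ^ k) ^ n * z) sums symmetric_Koebe k c z"
    by (simp add: symmetric_Koebe_def mult.commute)
  hence "(\<lambda>n. (- 2 / of_nat k gchoose Suc n) * (- c * z ^ k) ^ Suc n * z) sums (symmetric_Koebe k c z - z)"
    by (subst sums_Suc_iff) simp
  moreover have "(- c * z ^ k) ^ n * z = (- c) ^ n * z ^ (n * k + 1)" for n
    by (simp add: power_mult_distrib power_add mult_ac power_minus[of "c * z ^ k"] power_minus[of c] flip: power_mult)
  ultimately show "(\<lambda>n. (- 2 / of_nat k gchoose ((Suc n * k + 1 - 1) div k)) * (- c) ^ ((Suc n * k + 1 - 1) div k)
      * z ^ (Suc n * k + 1)) sums (symmetric_Koebe k c z - z)"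
    using k by (simp add: mult.assoc del: mult_Suc power_Suc)
qed

end

section \<open>The sharp estimate for the difference of squares\<close>

theorem theorem4:
  fixes k :: nat
  assumes "k \<ge> 1"
  shows "(\<forall>f a. f \<in> starlike_class \<and> has_gap_expansion k a f \<longrightarrow>
            cmod ((a (k + 1))\<^sup>2 - (a (2 * k + 1))\<^sup>2)
              \<le> 4 / (real k)\<^sup>2 + (real k + 2)\<^sup>2 / (real k) ^ 4)
       \<and> (\<exists>f a. f \<in> starlike_class \<and> has_gap_expansion k a f \<and>
            cmod ((a (k + 1))\<^sup>2 - (a (2 * k + 1))\<^sup>2)
              = 4 / (real k)\<^sup>2 + (real k + 2)\<^sup>2 / (real k) ^ 4)"
proof (intro conjI allI impI; (elim conjE)?)
  fix f a assume fa: "f \<in> starlike_class" "has_gap_expansion k a f"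
  have "cmod ((a (k + 1))\<^sup>2 - (a (2 * k + 1))\<^sup>2) \<le> cmod (a (k + 1)) ^ 2 + cmod (a (2 * k + 1)) ^ 2"
    unfolding norm_power[symmetric] by (rule norm_triangle_ineq4)
  also have "\<dots> \<le> (2 / k)\<^sup>2 + ((k + 2) / k\<^sup>2)\<^sup>2"
    using starlike_gap_coefficient_bounds[OF assms fa] by (intro add_mono power_mono) (simp_all add: add.commute)
  also have "\<dots> = 4 / (real k)\<^sup>2 + (real k + 2)\<^sup>2 / (real k) ^ 4"
    by (simp add: power_divide add.commute flip: power_mult)
  finally show "cmod ((a (k + 1))\<^sup>2 - (a (2 * k + 1))\<^sup>2) \<le> 4 / (real k)\<^sup>2 + (real k + 2)\<^sup>2 / (real k) ^ 4" .
next
  \<comment> \<open>These are the coefficients for \<open>c = \<i>\<close>: \<open>a (k + 1)\<close>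
    is imaginary and \<open>a (2 * k + 1)\<close> is real, so their squares have opposite
    signs.\<close>
  define a where "a = (\<lambda>m. (- 2 / of_nat k gchoose ((m - 1) div k)) * (- \<i>) ^ ((m - 1) div k))"
  have "a (k + 1) = 2 / of_nat k * \<i>"
    using assms by (simp add: a_def)
  hence 1: "(a (k + 1))\<^sup>2 = - of_real (4 / (real k)\<^sup>2)"
    by (simp add: power_mult_distrib power_divide)
  have "a (2 * k + 1) = - of_real ((real k + 2) / (real k)\<^sup>2)"
    using assms by (simp add: a_def gbinomial_prod_rev numeral_2_eq_2 field_simps)
  hence 2: "(a (2 * k + 1))\<^sup>2 = of_real ((real k + 2)\<^sup>2 / (real k) ^ 4)"
    by (simp add: power_divide flip: power_mult)
  have "(a (k + 1))\<^sup>2 - (a (2 * k + 1))\<^sup>2 = - of_real (4 / (real k)\<^sup>2 + (real k + 2)\<^sup>2 / (real k) ^ 4)"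
    unfolding 1 2 by simp
  hence "cmod ((a (k + 1))\<^sup>2 - (a (2 * k + 1))\<^sup>2) = 4 / (real k)\<^sup>2 + (real k + 2)\<^sup>2 / (real k) ^ 4"
    by (simp only: norm_minus_cancel norm_of_real) simp
  moreover have "has_gap_expansion k a (symmetric_Koebe k \<i>)"
    unfolding a_def using assms by (intro symmetric_Koebe_gap_expansion) auto
  moreover have "symmetric_Koebe k \<i> \<in> starlike_class"
    using assms by (intro symmetric_Koebe_starlike) auto
  ultimately show "\<exists>f a. f \<in> starlike_class \<and> has_gap_expansion k a f \<and>
      cmod ((a (k + 1))\<^sup>2 - (a (2 * k + 1))\<^sup>2) = 4 / (real k)\<^sup>2 + (real k + 2)\<^sup>2 / (real k) ^ 4"
    by blast
qed

end
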